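(* Let $X=\mathbb{R}^{\mathbb{R}_+}$ be the set of all functions from $\mathbb{R}_+=[0,\infty[$ to $\mathbb{R}$, equipped with the sticking topology. Let $\mathcal{F}$ be a $\sigma$-field on $\mathbb{R}_+$ containing the Borel sets, let $\mu$ be a measure on $\mathbb{R}_+$, and let $a\in\mathbb{R}_+$. Each of the following properties is preserved, i.e. the set of all $f\in X$ having the property is closed in $X$: (a) lower semi-continuity; upper semi-continuity; (b) right continuity; being càg (left continuous), càd (right continuous), làg (having left limits), làd (having right limits), càdlàg (right continuous with left limits), and likewise the other conjunctions of these properties; (c) local boundedness; (d) Borel measurability; $\mathcal{F}$-measurability; local $\mu$-integrability; approximate continuity at $a$; (e) continuity (respectively being càd, or any other of the properties listed in (b)) on a dense $G_\delta$ set; continuity (respectively being càd, or any other of the properties listed in (b)) outside a $\mu$-negligible set.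
   Context: For $f\in X$, $\varepsilon>0$ and $t_1,\dots,t_k\in\mathbb{R}_+$, put $$E^\varepsilon_{t_1,\ldots,t_k}(f)=\{g\in X : \exists \eta>0,\ \forall t\in\mathbb{R}_+\cap\bigcup_{i=1}^k]t_i-\eta,t_i+\eta[,\ |f(t)-g(t)|<\varepsilon\}.$$ A subset $U\subset X$ is open for the sticking topology iff for each $f\in U$ it contains some $E^\varepsilon_{t_1,\ldots,t_k}(f)$. In (e), the dense $G_\delta$ set and the $\mu$-negligible set may depend on the function. A function $h$ is approximately continuous at $a$ (in the sense used here) if there exists a Lebesgue negligible set $A\subset\mathbb{R}_+$ such that $h(a)=\lim_{x\to a,\ x\notin A}h(x)$.
   Formalization: Closedness of local μ-integrability is stated only for locally finite μ; for an arbitrary measure it fails (μ = dx/x on ]0,1/2[, f = 1/|log x| near 0, f(0) = 0: f is a limit of locally μ-integrable functions but is not one). *)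

theory Defs
  imports "HOL-Analysis.Analysis"
begin

abbreviation Rplus :: "real set" where
  "Rplus \<equiv> {0..}"

definition nbhd :: "real \<Rightarrow> real \<Rightarrow> real set" where
  "nbhd t \<eta> = Rplus \<inter> {t - \<eta> <..< t + \<eta>}"

text \<open>A function from \<open>Rplus\<close> to the reals is represented by a function on \<open>real\<close> that is
  \<open>undefined\<close> outside \<open>Rplus\<close>, so that equality is equality on \<open>Rplus\<close>.\<close>

definition fun_space :: "(real \<Rightarrow> real) set" where
  "fun_space = extensional Rplus"

text \<open>The points \<open>t\<^sub>1, \<dots>, t\<^sub>k\<close> are given by the finite set \<open>T\<close> of their values. The set below
  need not be open in the topology defined from it.\<close>

definition sticking_nbhd :: "real \<Rightarrow> real set \<Rightarrow> (real \<Rightarrow> real) \<Rightarrow> (real \<Rightarrow> real) set" where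
  "sticking_nbhd \<epsilon> T f =
     {g \<in> fun_space. \<exists>\<eta>>0. \<forall>t \<in> Rplus \<inter> (\<Union>s\<in>T. {s - \<eta> <..< s + \<eta>}). \<bar>f t - g t\<bar> < \<epsilon>}"

definition sticking_open :: "(real \<Rightarrow> real) set \<Rightarrow> bool" where
  "sticking_open U \<longleftrightarrow> U \<subseteq> fun_space \<and>
     (\<forall>f\<in>U. \<exists>\<epsilon>>0. \<exists>T. finite T \<and> T \<noteq> {} \<and> T \<subseteq> Rplus \<and> sticking_nbhd \<epsilon> T f \<subseteq> U)"

definition sticking_topology :: "(real \<Rightarrow> real) topology" where
  "sticking_topology = topology sticking_open"

lemma sticking_nbhd_mono:
  assumes "\<epsilon> \<le> \<epsilon>'" "T' \<subseteq> T"
  shows "sticking_nbhd \<epsilon> T f \<subseteq> sticking_nbhd \<epsilon>' T' f"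
proof
  fix g assume g: "g \<in> sticking_nbhd \<epsilon> T f"
  then obtain \<eta> where "\<eta> > 0"
    and "\<forall>t \<in> Rplus \<inter> (\<Union>s\<in>T. {s - \<eta> <..< s + \<eta>}). \<bar>f t - g t\<bar> < \<epsilon>"
    unfolding sticking_nbhd_def by blast
  then have "\<forall>t \<in> Rplus \<inter> (\<Union>s\<in>T'. {s - \<eta> <..< s + \<eta>}). \<bar>f t - g t\<bar> < \<epsilon>'"
    using assms by (meson IntE IntI UN_mono order_less_le_trans subsetD order_refl)
  then show "g \<in> sticking_nbhd \<epsilon>' T' f"
    using g \<open>\<eta> > 0\<close> unfolding sticking_nbhd_def by blast
qed

lemma istopology_sticking_open: "istopology sticking_open"
  unfolding istopology_def
proof (intro conjI allI impI)
  fix U V assume U: "sticking_open U" and V: "sticking_open V"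
  show "sticking_open (U \<inter> V)"
    unfolding sticking_open_def
  proof (intro conjI ballI)
    show "U \<inter> V \<subseteq> fun_space" using U unfolding sticking_open_def by blast
    fix f assume f: "f \<in> U \<inter> V"
    obtain \<epsilon> T where 1: "\<epsilon> > 0" "finite T" "T \<noteq> {}" "T \<subseteq> Rplus" "sticking_nbhd \<epsilon> T f \<subseteq> U"
      using U f unfolding sticking_open_def by blast
    obtain \<epsilon>' T' where 2: "\<epsilon>' > 0" "finite T'" "T' \<subseteq> Rplus" "sticking_nbhd \<epsilon>' T' f \<subseteq> V"
      using V f unfolding sticking_open_def by blast
    have "sticking_nbhd (min \<epsilon> \<epsilon>') (T \<union> T') f \<subseteq> U \<inter> V"
      using 1(5) 2(4) sticking_nbhd_mono[of "min \<epsilon> \<epsilon>'" \<epsilon> T "T \<union> T'" f]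
        sticking_nbhd_mono[of "min \<epsilon> \<epsilon>'" \<epsilon>' T' "T \<union> T'" f] by auto
    moreover have "min \<epsilon> \<epsilon>' > 0" "finite (T \<union> T')" "T \<union> T' \<noteq> {}" "T \<union> T' \<subseteq> Rplus"
      using 1 2 by auto
    ultimately show "\<exists>\<epsilon>>0. \<exists>T. finite T \<and> T \<noteq> {} \<and> T \<subseteq> Rplus \<and> sticking_nbhd \<epsilon> T f \<subseteq> U \<inter> V"
      by blast
  qed
next
  fix \<K> assume K: "\<forall>K\<in>\<K>. sticking_open K"
  show "sticking_open (\<Union>\<K>)"
    unfolding sticking_open_def
  proof (intro conjI ballI)
    show "\<Union>\<K> \<subseteq> fun_space" using K unfolding sticking_open_def by blast
    fix f assume "f \<in> \<Union>\<K>"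
    then obtain K' where "K' \<in> \<K>" "f \<in> K'" by blast
    then show "\<exists>\<epsilon>>0. \<exists>T. finite T \<and> T \<noteq> {} \<and> T \<subseteq> Rplus \<and> sticking_nbhd \<epsilon> T f \<subseteq> \<Union>\<K>"
      using K unfolding sticking_open_def by (meson Union_upper subset_trans)
  qed
qed

lemma openin_sticking_topology: "openin sticking_topology U \<longleftrightarrow> sticking_open U"
  unfolding sticking_topology_def
  by (simp add: topology_inverse' istopology_sticking_open)

lemma topspace_sticking_topology [simp]: "topspace sticking_topology = fun_space"
proof -
  have "sticking_open fun_space"
    unfolding sticking_open_def sticking_nbhd_def
    by (auto intro!: exI[of _ 1] exI[of _ "{0}"])
  then show ?thesis
    unfolding topspace_def openin_sticking_topology sticking_open_def by blast
qed

definition preserved :: "((real \<Rightarrow> real) \<Rightarrow> bool) \<Rightarrow> bool" where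
  "preserved P \<longleftrightarrow> closedin sticking_topology {f \<in> fun_space. P f}"

definition lower_semicont :: "(real \<Rightarrow> real) \<Rightarrow> bool" where
  "lower_semicont f \<longleftrightarrow> (\<forall>t\<in>Rplus. \<forall>c<f t. \<forall>\<^sub>F s in at t within Rplus. c < f s)"

definition upper_semicont :: "(real \<Rightarrow> real) \<Rightarrow> bool" where
  "upper_semicont f \<longleftrightarrow> (\<forall>t\<in>Rplus. \<forall>c>f t. \<forall>\<^sub>F s in at t within Rplus. f s < c)"

text \<open>Limits are finite. At \<open>t = 0\<close> the two left-hand notions hold vacuously, since
  the filters involved are trivial.\<close>

definition cont_at :: "(real \<Rightarrow> real) \<Rightarrow> real \<Rightarrow> bool" where
  "cont_at f t \<longleftrightarrow> continuous (at t within Rplus) f"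

definition right_cont_at :: "(real \<Rightarrow> real) \<Rightarrow> real \<Rightarrow> bool" where
  "right_cont_at f t \<longleftrightarrow> continuous (at t within {t..}) f"

definition left_cont_at :: "(real \<Rightarrow> real) \<Rightarrow> real \<Rightarrow> bool" where
  "left_cont_at f t \<longleftrightarrow> continuous (at t within {0..t}) f"

definition right_lim_at :: "(real \<Rightarrow> real) \<Rightarrow> real \<Rightarrow> bool" where
  "right_lim_at f t \<longleftrightarrow> (\<exists>l. (f \<longlongrightarrow> l) (at t within {t<..}))"

definition left_lim_at :: "(real \<Rightarrow> real) \<Rightarrow> real \<Rightarrow> bool" where
  "left_lim_at f t \<longleftrightarrow> (\<exists>l. (f \<longlongrightarrow> l) (at t within {0..<t}))"

definition one_sided :: "((real \<Rightarrow> real) \<Rightarrow> real \<Rightarrow> bool) set" where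
  "one_sided = {right_cont_at, left_cont_at, right_lim_at, left_lim_at}"

text \<open>\<open>Q\<close> is a set of pointwise properties, as in \<open>{right_cont_at, left_lim_at}\<close>.\<close>

definition all_at :: "((real \<Rightarrow> real) \<Rightarrow> real \<Rightarrow> bool) set \<Rightarrow> (real \<Rightarrow> real) \<Rightarrow> real \<Rightarrow> bool" where
  "all_at Q f t \<longleftrightarrow> (\<forall>P\<in>Q. P f t)"

definition everywhere :: "((real \<Rightarrow> real) \<Rightarrow> real \<Rightarrow> bool) \<Rightarrow> (real \<Rightarrow> real) \<Rightarrow> bool" where
  "everywhere P f \<longleftrightarrow> (\<forall>t\<in>Rplus. P f t)"

definition on_dense_gdelta :: "((real \<Rightarrow> real) \<Rightarrow> real \<Rightarrow> bool) \<Rightarrow> (real \<Rightarrow> real) \<Rightarrow> bool" where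
  "on_dense_gdelta P f \<longleftrightarrow>
     (\<exists>D. gdelta_in (top_of_set Rplus) D \<and> top_of_set Rplus closure_of D = Rplus \<and> (\<forall>t\<in>D. P f t))"

text \<open>A negligible set is a subset of a measurable null set.\<close>

definition outside_negligible ::
    "real measure \<Rightarrow> ((real \<Rightarrow> real) \<Rightarrow> real \<Rightarrow> bool) \<Rightarrow> (real \<Rightarrow> real) \<Rightarrow> bool" where
  "outside_negligible M P f \<longleftrightarrow>
     (\<exists>N. (\<exists>N'\<in>null_sets M. N \<subseteq> N') \<and> (\<forall>t\<in>Rplus - N. P f t))"

definition locally_bounded :: "(real \<Rightarrow> real) \<Rightarrow> bool" where
  "locally_bounded f \<longleftrightarrow> (\<forall>t\<in>Rplus. \<exists>\<eta>>0. bounded (f ` nbhd t \<eta>))"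

definition locally_finite_measure :: "real measure \<Rightarrow> bool" where
  "locally_finite_measure M \<longleftrightarrow> (\<forall>t\<in>Rplus. \<exists>\<eta>>0. emeasure M (nbhd t \<eta>) < \<infinity>)"

definition locally_integrable :: "real measure \<Rightarrow> (real \<Rightarrow> real) \<Rightarrow> bool" where
  "locally_integrable M f \<longleftrightarrow> (\<forall>t\<in>Rplus. \<exists>\<eta>>0. set_integrable M (nbhd t \<eta>) f)"

definition approx_cont_at :: "(real \<Rightarrow> real) \<Rightarrow> real \<Rightarrow> bool" where
  "approx_cont_at f a \<longleftrightarrow>
     (\<exists>A\<subseteq>Rplus. A \<in> null_sets lebesgue \<and> (f \<longlongrightarrow> f a) (at a within Rplus - A))"

abbreviation borel_Rplus :: "real measure" where
  "borel_Rplus \<equiv> restrict_space borel Rplus"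

end

theory Submission
  imports Defs
begin

text \<open>Every property is local: if near each point \<open>f\<close> is uniformly within every \<open>\<epsilon>\<close> of a function
  with the property, then \<open>f\<close> has it. For the properties tested at one point this is a direct
  estimate. For the others, Lindelof's theorem reduces the approximating functions to countably
  many; then Baire's theorem or countable subadditivity handles the exceptional sets, and gluing
  countably many pieces expresses \<open>f\<close> as a limit of measurable functions.\<close>

section \<open>Local approximation and closedness in the sticking topology\<close>

definition locally_approx :: "((real \<Rightarrow> real) \<Rightarrow> bool) \<Rightarrow> (real \<Rightarrow> real) \<Rightarrow> real \<Rightarrow> bool" where
  "locally_approx P f t \<longleftrightarrow>
     (\<forall>\<epsilon>>0. \<exists>g. P g \<and> (\<exists>\<eta>>0. \<forall>s\<in>nbhd t \<eta>. \<bar>f s - g s\<bar> < \<epsilon>))"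

lemma locally_approxE:
  assumes "locally_approx P f t" "\<epsilon> > 0"
  obtains g \<eta> where "P g" "\<eta> > 0" "\<And>s. s \<in> nbhd t \<eta> \<Longrightarrow> \<bar>f s - g s\<bar> < \<epsilon>"
  using assms unfolding locally_approx_def by blast

lemma locally_approx_mono:
  assumes "locally_approx P f t" and "\<And>g. P g \<Longrightarrow> Q g"
  shows "locally_approx Q f t"
  using assms unfolding locally_approx_def by blast

lemma nbhd_self: "t \<in> Rplus \<Longrightarrow> \<eta> > 0 \<Longrightarrow> t \<in> nbhd t \<eta>"
  by (simp add: nbhd_def)

lemma nbhd_mono: "\<eta> \<le> \<eta>' \<Longrightarrow> nbhd t \<eta> \<subseteq> nbhd t \<eta>'"
  by (auto simp: nbhd_def)

text \<open>Triangle inequality, with the radius left over after moving the centre. It transfers an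
  estimate around one centre to every point of that neighbourhood.\<close>

lemma nbhd_shrink:
  assumes "t \<in> nbhd s \<eta>"
  obtains \<eta>' where "\<eta>' > 0" "nbhd t \<eta>' \<subseteq> nbhd s \<eta>"
proof
  show "\<eta> - \<bar>t - s\<bar> > 0" "nbhd t (\<eta> - \<bar>t - s\<bar>) \<subseteq> nbhd s \<eta>"
    using assms by (auto simp: nbhd_def)
qed

lemma eventually_nbhd:
  assumes "\<eta> > 0" "S \<subseteq> Rplus"
  shows "\<forall>\<^sub>F s in at t within S. s \<in> nbhd t \<eta>"
  unfolding eventually_at nbhd_def using assms
  by (intro exI[of _ \<eta>]) (auto simp: dist_real_def)

lemma sets_nbhd:
  assumes "sets borel_Rplus \<subseteq> sets M"
  shows "nbhd t \<eta> \<in> sets M"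
  using assms by (auto simp: nbhd_def sets_restrict_space)

text \<open>If \<open>P f\<close> fails, some point \<open>t\<close> and some \<epsilon> admit no
  approximant with \<open>P\<close>, so the basic neighbourhood given by \<epsilon> and the single
  point \<open>t\<close> misses the set. Approximants in \<open>locally_approx\<close> need not lie
  in \<open>fun_space\<close>, so they may be built with arbitrary values off
  \<open>Rplus\<close>.\<close>

lemma preservedI:
  assumes "\<And>f. (\<And>t. t \<in> Rplus \<Longrightarrow> locally_approx P f t) \<Longrightarrow> P f"
  shows "preserved P"
proof -
  have "\<exists>\<epsilon>>0. \<exists>T. finite T \<and> T \<noteq> {} \<and> T \<subseteq> Rplus \<and>
      sticking_nbhd \<epsilon> T f \<subseteq> fun_space - {f \<in> fun_space. P f}"
    if "\<not> P f" for f
  proof -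
    obtain t where t: "t \<in> Rplus" "\<not> locally_approx P f t"
      using \<open>\<not> P f\<close> assms by blast
    then obtain \<epsilon> where "\<epsilon> > 0"
      and "\<And>g \<eta>. P g \<Longrightarrow> \<eta> > 0 \<Longrightarrow> \<exists>s\<in>nbhd t \<eta>. \<not> \<bar>f s - g s\<bar> < \<epsilon>"
      unfolding locally_approx_def by blast
    then have "sticking_nbhd \<epsilon> {t} f \<subseteq> fun_space - {f \<in> fun_space. P f}"
      unfolding sticking_nbhd_def nbhd_def by fastforce
    then show ?thesis
      using t \<open>\<epsilon> > 0\<close> by (intro exI[of _ \<epsilon>] conjI exI[of _ "{t}"]) auto
  qed
  then show ?thesis
    unfolding preserved_def closedin_def openin_sticking_topology sticking_open_def
    by auto
qed

text \<open>The approximants need \<open>P\<close> only at the point \<open>t\<close> itself. This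
  lets one closedness proof serve \<open>P\<close> at a single point, everywhere, on a dense G-delta
  set and outside a negligible set.\<close>

definition pointwise_closed :: "((real \<Rightarrow> real) \<Rightarrow> real \<Rightarrow> bool) \<Rightarrow> bool" where
  "pointwise_closed P \<longleftrightarrow> (\<forall>f. \<forall>t\<in>Rplus. locally_approx (\<lambda>g. P g t) f t \<longrightarrow> P f t)"

lemma pointwise_closedI:
  assumes "\<And>f t. t \<in> Rplus \<Longrightarrow> locally_approx (\<lambda>g. P g t) f t \<Longrightarrow> P f t"
  shows "pointwise_closed P"
  using assms unfolding pointwise_closed_def by blast

lemma pointwise_closedD:
  assumes "pointwise_closed P" "t \<in> Rplus" "locally_approx (\<lambda>g. P g t) f t"
  shows "P f t"
  using assms unfolding pointwise_closed_def by blast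

lemma pointwise_closed_all_at:
  assumes "\<And>P. P \<in> Q \<Longrightarrow> pointwise_closed P"
  shows "pointwise_closed (all_at Q)"
proof (rule pointwise_closedI)
  fix f t assume t: "t \<in> Rplus" and approx: "locally_approx (\<lambda>g. all_at Q g t) f t"
  have "P f t" if "P \<in> Q" for P
    using assms[OF that] t
  proof (rule pointwise_closedD)
    show "locally_approx (\<lambda>g. P g t) f t"
      using approx by (rule locally_approx_mono) (use that in \<open>auto simp: all_at_def\<close>)
  qed
  then show "all_at Q f t"
    unfolding all_at_def by blast
qed

lemma preserved_at:
  assumes "pointwise_closed P" "t \<in> Rplus"
  shows "preserved (\<lambda>f. P f t)"
  using assms by (intro preservedI) (rule pointwise_closedD)

lemma preserved_everywhere:
  assumes "pointwise_closed P"
  shows "preserved (everywhere P)"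
proof (rule preservedI)
  fix f assume approx: "\<And>t. t \<in> Rplus \<Longrightarrow> locally_approx (everywhere P) f t"
  have "P f t" if t: "t \<in> Rplus" for t
    using assms t
  proof (rule pointwise_closedD)
    show "locally_approx (\<lambda>g. P g t) f t"
      using approx[OF t] by (rule locally_approx_mono) (use t in \<open>simp add: everywhere_def\<close>)
  qed
  then show "everywhere P f"
    by (simp add: everywhere_def)
qed

subsection \<open>Properties tested at a point\<close>

text \<open>The usual \<epsilon>/3 argument along a filter. Closeness at \<open>t\<close> is a
  separate requirement because a punctured filter such as \<open>at t within S\<close> ignores the
  value at \<open>t\<close>.\<close>

lemma tendsto_of_approx:
  fixes f :: "'a \<Rightarrow> real"
  assumes "\<And>\<epsilon>. \<epsilon> > 0 \<Longrightarrow>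
    \<exists>g. (g \<longlongrightarrow> g t) F \<and> \<bar>f t - g t\<bar> < \<epsilon> \<and> (\<forall>\<^sub>F s in F. \<bar>f s - g s\<bar> < \<epsilon>)"
  shows "(f \<longlongrightarrow> f t) F"
proof (rule tendstoI)
  fix e :: real assume "e > 0"
  then obtain g where g: "(g \<longlongrightarrow> g t) F" "\<bar>f t - g t\<bar> < e/3" "\<forall>\<^sub>F s in F. \<bar>f s - g s\<bar> < e/3"
    using assms[of "e/3"] by auto
  have "\<forall>\<^sub>F s in F. dist (g s) (g t) < e/3"
    using tendstoD[OF g(1), of "e/3"] \<open>e > 0\<close> by simp
  with g(3) show "\<forall>\<^sub>F s in F. dist (f s) (f t) < e"
    by eventually_elim (use g(2) in \<open>simp add: dist_real_def abs_if split: if_splits\<close>)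
qed

text \<open>No limit of \<open>f\<close> is known in advance, so the image filter is shown to be
  Cauchy and completeness of the reals supplies the limit.\<close>

lemma convergent_of_approx:
  fixes f :: "'a \<Rightarrow> real"
  assumes approx: "\<And>\<epsilon>. \<epsilon> > 0 \<Longrightarrow> \<exists>g. (\<exists>l. (g \<longlongrightarrow> l) F) \<and> (\<forall>\<^sub>F s in F. \<bar>f s - g s\<bar> < \<epsilon>)"
  shows "\<exists>l. (f \<longlongrightarrow> l) F"
\<comment> \<open>Completeness speaks of proper filters only. The trivial filter does occur: it is
  the one for left limits at 0.\<close>
proof (cases "F = bot")
  case False
  have "cauchy_filter (filtermap f F)"
    unfolding cauchy_filter_metric_filtermap
  proof (intro allI impI)
    \<comment> \<open>Here \<open>l\<close> is the limit of \<open>g\<close>, not of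
      \<open>f\<close>. Two errors below \<open>e/4\<close> put \<open>f s\<close> within
      \<open>e/2\<close> of \<open>l\<close>, hence any two such values within \<open>e\<close> of
      each other.\<close>
    fix e :: real assume "e > 0"
    then obtain g l where g: "(g \<longlongrightarrow> l) F" "\<forall>\<^sub>F s in F. \<bar>f s - g s\<bar> < e/4"
      using approx[of "e/4"] by auto
    have "\<forall>\<^sub>F s in F. dist (g s) l < e/4"
      using tendstoD[OF g(1), of "e/4"] \<open>e > 0\<close> by simp
    with g(2) have "\<forall>\<^sub>F s in F. dist (f s) l < e/2"
      by eventually_elim (simp add: dist_real_def abs_if split: if_splits)
    moreover have "dist (f x) (f y) < e" if "dist (f x) l < e/2" "dist (f y) l < e/2" for x y
      using that by (rule dist_triangle_half_l)
    ultimately show "\<exists>P. eventually P F \<and> (\<forall>x y. P x \<and> P y \<longrightarrow> dist (f x) (f y) < e)"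
      by blast
  qed
  moreover have "complete (UNIV :: real set)"
    by (simp add: complete_eq_closed)
  ultimately show ?thesis
    using False complete_uniform[where S = "UNIV :: real set"]
    by (force simp: filterlim_def filtermap_bot_iff)
qed simp

text \<open>Letting \<open>S\<close> depend on the point covers two-sided, right and left continuity
  at once. As \<open>S t\<close> lies in \<open>Rplus\<close>, an estimate on
  \<open>nbhd t \<eta>\<close> holds eventually along the filter.\<close>

lemma pointwise_closed_continuous_within:
  assumes "\<And>t. t \<in> Rplus \<Longrightarrow> S t \<subseteq> Rplus"
  shows "pointwise_closed (\<lambda>f t. continuous (at t within S t) f)"
proof (rule pointwise_closedI)
  fix f :: "real \<Rightarrow> real" and t
  assume t: "t \<in> Rplus" and approx: "locally_approx (continuous (at t within S t)) f t"
  show "continuous (at t within S t) f"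
    unfolding continuous_within
  proof (rule tendsto_of_approx)
    fix \<epsilon> :: real assume "\<epsilon> > 0"
    with approx obtain g \<eta> where g: "continuous (at t within S t) g" "\<eta> > 0"
      "\<And>s. s \<in> nbhd t \<eta> \<Longrightarrow> \<bar>f s - g s\<bar> < \<epsilon>"
      by (rule locally_approxE) blast
    moreover have "\<forall>\<^sub>F s in at t within S t. \<bar>f s - g s\<bar> < \<epsilon>"
      by (rule eventually_mono[OF eventually_nbhd[OF \<open>\<eta> > 0\<close> assms[OF t], of t] g(3)])
    ultimately show "\<exists>g. (g \<longlongrightarrow> g t) (at t within S t) \<and> \<bar>f t - g t\<bar> < \<epsilon> \<and>
        (\<forall>\<^sub>F s in at t within S t. \<bar>f s - g s\<bar> < \<epsilon>)"
      using nbhd_self[OF t \<open>\<eta> > 0\<close>] unfolding continuous_within by blast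
  qed
qed

lemma pointwise_closed_convergent_within:
  assumes "\<And>t. t \<in> Rplus \<Longrightarrow> S t \<subseteq> Rplus"
  shows "pointwise_closed (\<lambda>f t. \<exists>l. (f \<longlongrightarrow> l) (at t within S t))"
proof (rule pointwise_closedI)
  fix f :: "real \<Rightarrow> real" and t
  assume t: "t \<in> Rplus" and approx: "locally_approx (\<lambda>g. \<exists>l. (g \<longlongrightarrow> l) (at t within S t)) f t"
  show "\<exists>l. (f \<longlongrightarrow> l) (at t within S t)"
  proof (rule convergent_of_approx)
    fix \<epsilon> :: real assume "\<epsilon> > 0"
    with approx obtain g \<eta> where g: "\<exists>l. (g \<longlongrightarrow> l) (at t within S t)" "\<eta> > 0"
      "\<And>s. s \<in> nbhd t \<eta> \<Longrightarrow> \<bar>f s - g s\<bar> < \<epsilon>"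
      by (rule locally_approxE) blast
    moreover have "\<forall>\<^sub>F s in at t within S t. \<bar>f s - g s\<bar> < \<epsilon>"
      by (rule eventually_mono[OF eventually_nbhd[OF \<open>\<eta> > 0\<close> assms[OF t], of t] g(3)])
    ultimately show "\<exists>g. (\<exists>l. (g \<longlongrightarrow> l) (at t within S t)) \<and>
        (\<forall>\<^sub>F s in at t within S t. \<bar>f s - g s\<bar> < \<epsilon>)"
      by blast
  qed
qed

lemma pointwise_closed_cont_at: "pointwise_closed cont_at"
  unfolding cont_at_def[abs_def] by (rule pointwise_closed_continuous_within) simp

lemma pointwise_closed_one_sided:
  assumes "P \<in> one_sided"
  shows "pointwise_closed P"
proof -
  have "pointwise_closed right_cont_at" "pointwise_closed left_cont_at"
    unfolding right_cont_at_def[abs_def] left_cont_at_def[abs_def]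
    by (intro pointwise_closed_continuous_within; auto)+
  moreover have "pointwise_closed right_lim_at" "pointwise_closed left_lim_at"
    unfolding right_lim_at_def[abs_def] left_lim_at_def[abs_def]
    by (intro pointwise_closed_convergent_within; auto)+
  ultimately show ?thesis
    using assms by (auto simp: one_sided_def)
qed

section \<open>Semicontinuity, local boundedness and approximate continuity\<close>

lemma preserved_lower_semicont: "preserved lower_semicont"
proof -
  let ?P = "\<lambda>f t. \<forall>c<f t. \<forall>\<^sub>F s in at t within Rplus. c < (f s :: real)"
  have "pointwise_closed ?P"
  proof (intro pointwise_closedI allI impI)
    fix f t c assume t: "t \<in> Rplus" and approx: "locally_approx (\<lambda>g. ?P g t) f t" and "c < f t"
    \<comment> \<open>Half the gap: one \<epsilon> is lost in passing from \<open>f t\<close> to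
      \<open>g t\<close>, the other in returning from \<open>g s\<close> to
      \<open>f s\<close>.\<close>
    define \<epsilon> where "\<epsilon> = (f t - c) / 2"
    have "\<epsilon> > 0" using \<open>c < f t\<close> by (simp add: \<epsilon>_def)
    with approx obtain g \<eta> where g: "?P g t" "\<eta> > 0" "\<And>s. s \<in> nbhd t \<eta> \<Longrightarrow> \<bar>f s - g s\<bar> < \<epsilon>"
      by (rule locally_approxE) blast
    have "c + \<epsilon> < g t"
      using g(3)[OF nbhd_self[OF t \<open>\<eta> > 0\<close>]] unfolding \<epsilon>_def
      by (simp add: abs_if field_simps split: if_splits)
    with g(1) have "\<forall>\<^sub>F s in at t within Rplus. c + \<epsilon> < g s" by blast
    moreover have "\<forall>\<^sub>F s in at t within Rplus. s \<in> nbhd t \<eta>"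
      using \<open>\<eta> > 0\<close> by (rule eventually_nbhd) simp
    ultimately show "\<forall>\<^sub>F s in at t within Rplus. c < f s"
      by eventually_elim (use g(3) in fastforce)
  qed
  then have "preserved (everywhere ?P)" by (rule preserved_everywhere)
  then show ?thesis
    by (simp add: everywhere_def[abs_def] lower_semicont_def[abs_def])
qed

lemma preserved_upper_semicont: "preserved upper_semicont"
proof -
  let ?P = "\<lambda>f t. \<forall>c>f t. \<forall>\<^sub>F s in at t within Rplus. (f s :: real) < c"
  have "pointwise_closed ?P"
  proof (intro pointwise_closedI allI impI)
    fix f t c assume t: "t \<in> Rplus" and approx: "locally_approx (\<lambda>g. ?P g t) f t" and "f t < c"
    define \<epsilon> where "\<epsilon> = (c - f t) / 2"
    have "\<epsilon> > 0" using \<open>f t < c\<close> by (simp add: \<epsilon>_def)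
    with approx obtain g \<eta> where g: "?P g t" "\<eta> > 0" "\<And>s. s \<in> nbhd t \<eta> \<Longrightarrow> \<bar>f s - g s\<bar> < \<epsilon>"
      by (rule locally_approxE) blast
    have "g t < c - \<epsilon>"
      using g(3)[OF nbhd_self[OF t \<open>\<eta> > 0\<close>]] unfolding \<epsilon>_def
      by (simp add: abs_if field_simps split: if_splits)
    with g(1) have "\<forall>\<^sub>F s in at t within Rplus. g s < c - \<epsilon>" by blast
    moreover have "\<forall>\<^sub>F s in at t within Rplus. s \<in> nbhd t \<eta>"
      using \<open>\<eta> > 0\<close> by (rule eventually_nbhd) simp
    ultimately show "\<forall>\<^sub>F s in at t within Rplus. f s < c"
      by eventually_elim (use g(3) in fastforce)
  qed
  then have "preserved (everywhere ?P)" by (rule preserved_everywhere)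
  then show ?thesis
    by (simp add: everywhere_def[abs_def] upper_semicont_def[abs_def])
qed

text \<open>A single approximant at scale 1 suffices: on the smaller of the two radii, its bound
  plus 1 bounds \<open>f\<close>.\<close>

lemma preserved_locally_bounded: "preserved locally_bounded"
proof -
  let ?P = "\<lambda>f t. \<exists>\<eta>>0. bounded ((f :: real \<Rightarrow> real) ` nbhd t \<eta>)"
  have "pointwise_closed ?P"
  proof (rule pointwise_closedI)
    fix f t assume "locally_approx (\<lambda>g. ?P g t) f t"
    then obtain g \<eta> where g: "?P g t" "\<eta> > 0" "\<And>s. s \<in> nbhd t \<eta> \<Longrightarrow> \<bar>f s - g s\<bar> < 1"
      by (rule locally_approxE[OF _ zero_less_one]) blast
    then obtain \<eta>' B where B: "\<eta>' > 0" "\<And>s. s \<in> nbhd t \<eta>' \<Longrightarrow> \<bar>g s\<bar> \<le> B"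
      by (auto simp: bounded_iff)
    have "\<bar>f s\<bar> \<le> B + 1" if "s \<in> nbhd t (min \<eta> \<eta>')" for s
    proof -
      have "s \<in> nbhd t \<eta>" "s \<in> nbhd t \<eta>'"
        using that by (auto simp: nbhd_def)
      then show ?thesis using g(3)[of s] B(2)[of s] by linarith
    qed
    then have "bounded (f ` nbhd t (min \<eta> \<eta>'))"
      by (auto simp: bounded_iff)
    then show "?P f t"
      using \<open>\<eta> > 0\<close> \<open>\<eta>' > 0\<close> by (intro exI[of _ "min \<eta> \<eta>'"]) simp
  qed
  then have "preserved (everywhere ?P)" by (rule preserved_everywhere)
  then show ?thesis
    by (simp add: everywhere_def[abs_def] locally_bounded_def[abs_def])
qed

text \<open>The null set to be avoided varies with the approximant, hence with \<epsilon>. Using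
  only the scales \<open>1/(n+1)\<close> leaves countably many null sets, and their union serves
  every \<epsilon>.\<close>

lemma pointwise_closed_approx_cont_at: "pointwise_closed approx_cont_at"
proof (rule pointwise_closedI)
  fix f t assume t: "t \<in> Rplus" and approx: "locally_approx (\<lambda>g. approx_cont_at g t) f t"
  have "\<exists>g. approx_cont_at g t \<and> (\<exists>\<eta>>0. \<forall>s\<in>nbhd t \<eta>. \<bar>f s - g s\<bar> < inverse (Suc n))" for n
    using approx unfolding locally_approx_def by (auto simp del: of_nat_Suc)
  then obtain g \<eta> where g: "\<And>n. approx_cont_at (g n) t" "\<And>n. \<eta> n > 0"
    "\<And>n s. s \<in> nbhd t (\<eta> n) \<Longrightarrow> \<bar>f s - g n s\<bar> < inverse (Suc n)"
    by metis
  obtain A where A: "\<And>n. A n \<subseteq> Rplus" "\<And>n. A n \<in> null_sets lebesgue"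
    "\<And>n. (g n \<longlongrightarrow> g n t) (at t within Rplus - A n)"
    using g(1) unfolding approx_cont_at_def by metis
  let ?A = "\<Union>n. A n"
  have "(f \<longlongrightarrow> f t) (at t within Rplus - ?A)"
  proof (rule tendsto_of_approx)
    fix \<epsilon> :: real assume "\<epsilon> > 0"
    then obtain n where n: "inverse (real (Suc n)) < \<epsilon>"
      using reals_Archimedean by blast
    have close: "\<bar>f s - g n s\<bar> < \<epsilon>" if "s \<in> nbhd t (\<eta> n)" for s
      using g(3)[OF that] n by linarith
    have "(g n \<longlongrightarrow> g n t) (at t within Rplus - ?A)"
      using A(3)[of n] by (rule tendsto_within_subset) auto
    moreover have "\<forall>\<^sub>F s in at t within Rplus - ?A. \<bar>f s - g n s\<bar> < \<epsilon>"
      using eventually_nbhd[OF g(2)[of n], of "Rplus - ?A" t] close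
      by (auto elim: eventually_mono)
    ultimately show "\<exists>g. (g \<longlongrightarrow> g t) (at t within Rplus - ?A) \<and> \<bar>f t - g t\<bar> < \<epsilon> \<and>
        (\<forall>\<^sub>F s in at t within Rplus - ?A. \<bar>f s - g s\<bar> < \<epsilon>)"
      using close[OF nbhd_self[OF t g(2)]] by blast
  qed
  then show "approx_cont_at f t"
    unfolding approx_cont_at_def using A by (intro exI[of _ ?A]) auto
qed

subsection \<open>Reduction to countably many approximating functions\<close>

text \<open>Lindelof's theorem is applied to the full open intervals, since the sets
  \<open>nbhd\<close> are open only relative to \<open>Rplus\<close>. The countable subfamily is
  then indexed by countably many centres.\<close>

lemma countable_nbhd_cover:
  assumes "\<And>t. t \<in> Rplus \<Longrightarrow> \<eta> t > 0"
  obtains C where "countable C" "C \<subseteq> Rplus" "Rplus \<subseteq> (\<Union>t\<in>C. nbhd t (\<eta> t))"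
proof -
  let ?I = "\<lambda>t. {t - \<eta> t<..<t + \<eta> t}"
  obtain \<V> where V: "\<V> \<subseteq> ?I ` Rplus" "countable \<V>" "\<Union>\<V> = \<Union>(?I ` Rplus)"
  proof (rule Lindelof)
    show "open S" if "S \<in> ?I ` Rplus" for S
      using that by (auto simp only: open_greaterThanLessThan)
  qed
  then obtain C where C: "countable C" "C \<subseteq> Rplus" "\<V> = ?I ` C"
    using countable_subset_image[of \<V> ?I Rplus] by blast
  have "Rplus \<subseteq> (\<Union>t\<in>C. nbhd t (\<eta> t))"
  proof
    fix s assume s: "s \<in> Rplus"
    then have "s \<in> ?I s" using assms[of s] by simp
    with s have "s \<in> \<Union>(?I ` Rplus)" by (rule UN_I)
    then have "s \<in> \<Union>(?I ` C)" by (simp only: V(3)[symmetric] C(3))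
    then show "s \<in> (\<Union>t\<in>C. nbhd t (\<eta> t))"
      using s by (auto simp: nbhd_def)
  qed
  with C(1,2) show ?thesis by (rule that)
qed

text \<open>Choose an approximant and a radius at each point and keep only the centres of a
  countable subcover. A point covered by the neighbourhood of \<open>c\<close> inherits the estimate
  for \<open>g c\<close> on a smaller neighbourhood of its own.\<close>

lemma countable_approx_at_scale:
  assumes approx: "\<And>t. t \<in> Rplus \<Longrightarrow> locally_approx P f t" and "\<epsilon> > 0"
  obtains G where "countable G" "\<And>g. g \<in> G \<Longrightarrow> P g"
    "\<And>t. t \<in> Rplus \<Longrightarrow> \<exists>g\<in>G. \<exists>\<eta>>0. \<forall>s\<in>nbhd t \<eta>. \<bar>f s - g s\<bar> < \<epsilon>"
proof -
  have "\<forall>t\<in>Rplus. \<exists>g. P g \<and> (\<exists>\<eta>>0. \<forall>s\<in>nbhd t \<eta>. \<bar>f s - g s\<bar> < \<epsilon>)"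
    using approx \<open>\<epsilon> > 0\<close> unfolding locally_approx_def by blast
  then obtain g where "\<forall>t\<in>Rplus. P (g t) \<and> (\<exists>\<eta>>0. \<forall>s\<in>nbhd t \<eta>. \<bar>f s - g t s\<bar> < \<epsilon>)"
    by (rule bchoice[THEN exE])
  moreover from this obtain \<eta> where
    \<eta>: "\<forall>t\<in>Rplus. \<eta> t > 0 \<and> (\<forall>s\<in>nbhd t (\<eta> t). \<bar>f s - g t s\<bar> < \<epsilon>)"
    using bchoice[of Rplus "\<lambda>t \<eta>. \<eta> > 0 \<and> (\<forall>s\<in>nbhd t \<eta>. \<bar>f s - g t s\<bar> < \<epsilon>)"] by blast
  moreover obtain C where C: "countable C" "C \<subseteq> Rplus" "Rplus \<subseteq> (\<Union>t\<in>C. nbhd t (\<eta> t))"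
    using countable_nbhd_cover[of \<eta>] \<eta> by blast
  moreover have "\<exists>h\<in>g ` C. \<exists>\<delta>>0. \<forall>s\<in>nbhd t \<delta>. \<bar>f s - h s\<bar> < \<epsilon>" if "t \<in> Rplus" for t
  proof -
    obtain c where c: "c \<in> C" "t \<in> nbhd c (\<eta> c)"
      using C(3) \<open>t \<in> Rplus\<close> by blast
    then obtain \<delta> where "\<delta> > 0" "nbhd t \<delta> \<subseteq> nbhd c (\<eta> c)"
      using nbhd_shrink by blast
    then show ?thesis
      using \<eta> C(2) c(1) by blast
  qed
  ultimately show ?thesis
    using that[of "g ` C"] by blast
qed

text \<open>The union over the scales \<open>1/(n+1)\<close> gives one countable family that works
  at all points and all scales, so only countably many exceptional sets ever have to be
  combined.\<close>

lemma countable_approx: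
  assumes approx: "\<And>t. t \<in> Rplus \<Longrightarrow> locally_approx P f t"
  obtains G where "countable G" "\<And>g. g \<in> G \<Longrightarrow> P g"
    "\<And>t. t \<in> Rplus \<Longrightarrow> locally_approx (\<lambda>g. g \<in> G) f t"
proof -
  have "\<exists>G. countable G \<and> (\<forall>g\<in>G. P g) \<and>
      (\<forall>t\<in>Rplus. \<exists>g\<in>G. \<exists>\<eta>>0. \<forall>s\<in>nbhd t \<eta>. \<bar>f s - g s\<bar> < inverse (real (Suc n)))" for n
    by (rule countable_approx_at_scale[OF approx, where \<epsilon> = "inverse (real (Suc n))"]) auto
  then obtain G where G: "\<And>n. countable (G n)" "\<And>n g. g \<in> G n \<Longrightarrow> P g"
    "\<And>n. \<forall>t\<in>Rplus. \<exists>g\<in>G n. \<exists>\<eta>>0. \<forall>s\<in>nbhd t \<eta>. \<bar>f s - g s\<bar> < inverse (real (Suc n))"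
    by metis
  show ?thesis
  proof
    show "countable (\<Union>n. G n)" using G(1) by simp
    show "P g" if "g \<in> (\<Union>n. G n)" for g using that G(2) by blast
    show "locally_approx (\<lambda>g. g \<in> (\<Union>n. G n)) f t" if "t \<in> Rplus" for t
      unfolding locally_approx_def
    proof (intro allI impI)
      fix \<epsilon> :: real assume "\<epsilon> > 0"
      then obtain n where n: "inverse (real (Suc n)) < \<epsilon>"
        using reals_Archimedean by blast
      obtain g \<eta> where "g \<in> G n" "\<eta> > 0"
        "\<forall>s\<in>nbhd t \<eta>. \<bar>f s - g s\<bar> < inverse (real (Suc n))"
        using G(3) \<open>t \<in> Rplus\<close> by blast
      then show "\<exists>g. g \<in> (\<Union>n. G n) \<and> (\<exists>\<eta>>0. \<forall>s\<in>nbhd t \<eta>. \<bar>f s - g s\<bar> < \<epsilon>)"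
        using n order.strict_trans by blast
    qed
  qed
qed

section \<open>Exceptional sets: Baire category and countable unions of null sets\<close>

text \<open>Each \<open>D i\<close> is a countable intersection of open sets, all dense because they
  contain \<open>D i\<close>. Baire's theorem applies to all these open sets together. An empty
  index set would give \<open>UNIV\<close> as intersection, which may leave the space.\<close>

lemma dense_gdelta_INT:
  assumes X: "completely_metrizable_space X" and "countable I" "I \<noteq> {}"
    and gdelta: "\<And>i. i \<in> I \<Longrightarrow> gdelta_in X (D i)"
    and dense: "\<And>i. i \<in> I \<Longrightarrow> X closure_of D i = topspace X"
  shows "gdelta_in X (\<Inter>i\<in>I. D i)" "X closure_of (\<Inter>i\<in>I. D i) = topspace X"
proof -
  show "gdelta_in X (\<Inter>i\<in>I. D i)"
    using assms by (intro gdelta_in_Inter) auto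
  have "\<exists>U :: nat \<Rightarrow> _. (\<forall>n. openin X (U n)) \<and> \<Inter>(range U) = D i" if "i \<in> I" for i
    using gdelta[OF that] unfolding gdelta_in_descending by blast
  then obtain U :: "_ \<Rightarrow> nat \<Rightarrow> _" where
    U: "\<And>i n. i \<in> I \<Longrightarrow> openin X (U i n)" "\<And>i. i \<in> I \<Longrightarrow> \<Inter>(range (U i)) = D i"
    by metis
  have "X closure_of \<Inter>(\<Union>i\<in>I. range (U i)) = topspace X"
  proof (rule Baire_category)
    show "completely_metrizable_space X \<or> locally_compact_space X \<and> regular_space X"
      using X by blast
    show "countable (\<Union>i\<in>I. range (U i))"
      using \<open>countable I\<close> by simp
    fix T assume "T \<in> (\<Union>i\<in>I. range (U i))"
    then obtain i n where i: "i \<in> I" "T = U i n" by blast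
    then have "D i \<subseteq> T" using U(2)[of i] by blast
    then have "topspace X \<subseteq> X closure_of T"
      using dense[OF i(1)] closure_of_mono by metis
    then show "openin X T \<and> X closure_of T = topspace X"
      using U(1) i closure_of_subset_topspace[of X T] by blast
  qed
  moreover have "\<Inter>(\<Union>i\<in>I. range (U i)) = (\<Inter>i\<in>I. D i)"
    using U(2) by blast
  ultimately show "X closure_of (\<Inter>i\<in>I. D i) = topspace X"
    by simp
qed

lemma preserved_on_dense_gdelta:
  assumes closed: "pointwise_closed P"
  shows "preserved (on_dense_gdelta P)"
proof (rule preservedI)
  fix f assume "\<And>t. t \<in> Rplus \<Longrightarrow> locally_approx (on_dense_gdelta P) f t"
  then obtain G where G: "countable G" "\<And>g. g \<in> G \<Longrightarrow> on_dense_gdelta P g"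
    "\<And>t. t \<in> Rplus \<Longrightarrow> locally_approx (\<lambda>g. g \<in> G) f t"
    using countable_approx by blast
  obtain D where D: "\<And>g. g \<in> G \<Longrightarrow> gdelta_in (top_of_set Rplus) (D g)"
    "\<And>g. g \<in> G \<Longrightarrow> top_of_set Rplus closure_of D g = Rplus"
    "\<And>g t. g \<in> G \<Longrightarrow> t \<in> D g \<Longrightarrow> P g t"
    using G(2) unfolding on_dense_gdelta_def by metis
  have "G \<noteq> {}"
    by (rule locally_approxE[OF G(3)[of 0] zero_less_one]) auto
  \<comment> \<open>A closed subset of the complete real line, so Baire's theorem is available on
    \<open>Rplus\<close>.\<close>
  have complete: "completely_metrizable_space (top_of_set Rplus)"
    by (simp add: completely_metrizable_space_closedin completely_metrizable_space_euclidean)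
  have dense_gdelta: "gdelta_in (top_of_set Rplus) (\<Inter>g\<in>G. D g)"
    "top_of_set Rplus closure_of (\<Inter>g\<in>G. D g) = Rplus"
    using dense_gdelta_INT[OF complete \<open>countable G\<close> \<open>G \<noteq> {}\<close>, of D] D(1,2) by auto
  \<comment> \<open>At such a point every member of \<open>G\<close> has \<open>P\<close>, so
    approximation by \<open>G\<close> is approximation by functions with \<open>P\<close> at
    \<open>t\<close>.\<close>
  moreover have "P f t" if t: "t \<in> (\<Inter>g\<in>G. D g)" for t
    using closed
  proof (rule pointwise_closedD)
    show "t \<in> Rplus"
      using t gdelta_in_subset[OF dense_gdelta(1)] by auto
    then have "locally_approx (\<lambda>g. g \<in> G) f t" by (rule G(3))
    then show "locally_approx (\<lambda>g. P g t) f t"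
      by (rule locally_approx_mono) (use t D(3) in auto)
  qed
  ultimately show "on_dense_gdelta P f"
    unfolding on_dense_gdelta_def by blast
qed

lemma preserved_outside_negligible:
  assumes closed: "pointwise_closed P"
  shows "preserved (outside_negligible M P)"
proof (rule preservedI)
  fix f assume "\<And>t. t \<in> Rplus \<Longrightarrow> locally_approx (outside_negligible M P) f t"
  then obtain G where G: "countable G" "\<And>g. g \<in> G \<Longrightarrow> outside_negligible M P g"
    "\<And>t. t \<in> Rplus \<Longrightarrow> locally_approx (\<lambda>g. g \<in> G) f t"
    using countable_approx by blast
  \<comment> \<open>Enlarging each negligible set to a measurable null set only shrinks its
    complement, and it makes countable subadditivity applicable.\<close>
  have "\<exists>N'\<in>null_sets M. \<forall>t\<in>Rplus - N'. P g t" if "g \<in> G" for g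
    using G(2)[OF that] unfolding outside_negligible_def by blast
  then obtain N where N: "\<And>g. g \<in> G \<Longrightarrow> N g \<in> null_sets M"
    "\<And>g t. g \<in> G \<Longrightarrow> t \<in> Rplus - N g \<Longrightarrow> P g t"
    by metis
  have "(\<Union>g\<in>G. N g) \<in> null_sets M"
    using \<open>countable G\<close> N(1) by (rule null_sets_UN')
  moreover have "P f t" if t: "t \<in> Rplus - (\<Union>g\<in>G. N g)" for t
    using closed
  proof (rule pointwise_closedD)
    show "t \<in> Rplus" using t by blast
    then have "locally_approx (\<lambda>g. g \<in> G) f t" by (rule G(3))
    then show "locally_approx (\<lambda>g. P g t) f t"
      by (rule locally_approx_mono) (use t N(2) in auto)
  qed
  ultimately show "outside_negligible M P f"
    unfolding outside_negligible_def by blast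
qed

subsection \<open>Measurability and integrability\<close>

text \<open>At each scale, \<open>f\<close> is approximated by a function glued from countably many
  measurable ones along Borel pieces. These glued functions converge pointwise to
  \<open>f\<close>.\<close>

lemma borel_measurable_of_locally_approx:
  assumes space: "space M = Rplus" and borel: "sets borel_Rplus \<subseteq> sets M"
    and approx: "\<And>t. t \<in> Rplus \<Longrightarrow> locally_approx (\<lambda>g. g \<in> borel_measurable M) f t"
  shows "f \<in> borel_measurable M"
proof -
  obtain G where G: "countable G" "\<And>g. g \<in> G \<Longrightarrow> g \<in> borel_measurable M"
    "\<And>t. t \<in> Rplus \<Longrightarrow> locally_approx (\<lambda>g. g \<in> G) f t"
    using countable_approx[OF approx] by blast
  have "G \<noteq> {}"
    by (rule locally_approxE[OF G(3)[of 0] zero_less_one]) auto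
  \<comment> \<open>An enumeration of the nonempty family \<open>G\<close>, with repetitions if
    \<open>G\<close> is finite.\<close>
  define g where "g = from_nat_into G"
  have range_g: "range g = G"
    unfolding g_def using \<open>G \<noteq> {}\<close> \<open>countable G\<close> by (rule range_from_nat_into)
  have g [measurable]: "g k \<in> borel_measurable M" for k
    using G(2) range_g by blast
  \<comment> \<open>The estimate is required on a whole neighbourhood, not just at \<open>s\<close>.
    This makes \<open>W n k\<close> relatively open on \<open>Rplus\<close>, hence measurable there
    before anything is known about the measurability of \<open>f\<close>.\<close>
  define W where "W n k = {s. \<exists>\<eta>>0. \<forall>r\<in>nbhd s \<eta>. \<bar>f r - g k r\<bar> < inverse (Suc n)}" for n k
  have W_close: "\<bar>f s - g k s\<bar> < inverse (Suc n)" if "s \<in> Rplus" "s \<in> W n k" for n k s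
    using that nbhd_self unfolding W_def by blast
  have W_cover: "\<exists>k. s \<in> W n k" if "s \<in> Rplus" for n s
  proof -
    obtain h \<eta> where "h \<in> G" "\<eta> > 0" "\<forall>r\<in>nbhd s \<eta>. \<bar>f r - h r\<bar> < inverse (Suc n)"
      by (rule locally_approxE[OF G(3)[OF \<open>s \<in> Rplus\<close>], of "inverse (Suc n)"]) auto
    then show ?thesis unfolding W_def using range_g by blast
  qed
  have W_meas [measurable]: "Measurable.pred M (\<lambda>s. s \<in> W n k)" for n k
  proof -
    \<comment> \<open>The intersection with \<open>Rplus\<close> matters: \<open>W n k\<close> also
      contains every negative number, because its small neighbourhoods \<open>nbhd\<close> are
      empty.\<close>
    have "openin (top_of_set Rplus) (Rplus \<inter> W n k)"
      unfolding openin_euclidean_subtopology_iff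
    proof (intro conjI ballI)
      fix s assume s: "s \<in> Rplus \<inter> W n k"
      then obtain \<eta> where \<eta>: "\<eta> > 0" "\<forall>r\<in>nbhd s \<eta>. \<bar>f r - g k r\<bar> < inverse (Suc n)"
        unfolding W_def by blast
      have "x \<in> W n k" if "x \<in> Rplus" "dist x s < \<eta>" for x
      proof -
        have "x \<in> nbhd s \<eta>" using that by (auto simp: nbhd_def dist_real_def)
        then obtain \<delta> where "\<delta> > 0" "nbhd x \<delta> \<subseteq> nbhd s \<eta>" using nbhd_shrink by blast
        then show ?thesis unfolding W_def using \<eta>(2) by blast
      qed
      then show "\<exists>e>0. \<forall>x\<in>Rplus. dist x s < e \<longrightarrow> x \<in> Rplus \<inter> W n k"
        using \<eta>(1) by blast
    qed simp
    then obtain V where "open V" "Rplus \<inter> W n k = Rplus \<inter> V"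
      by (auto simp: openin_open)
    then have "Rplus \<inter> W n k \<in> sets M"
      using borel by (auto simp: sets_restrict_space)
    moreover have "{s \<in> space M. s \<in> W n k} = Rplus \<inter> W n k"
      using space by auto
    ultimately show ?thesis by (simp add: pred_def)
  qed
  \<comment> \<open>Taking the least admissible index turns the overlapping cover into a disjoint
    measurable partition, with \<open>g k\<close> used on the \<open>k\<close>-th piece.\<close>
  define h where "h n s = g (LEAST k. s \<in> W n k) s" for n s
  have h_meas: "h n \<in> borel_measurable M" for n
    unfolding h_def
    by (rule measurable_compose_countable'[where f = g and I = UNIV]) measurable
  have "(\<lambda>n. h n s) \<longlonglongrightarrow> f s" if "s \<in> space M" for s
  proof -
    have s: "s \<in> Rplus" using that space by simp
    have close: "\<bar>f s - h n s\<bar> < inverse (Suc n)" for n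
      unfolding h_def using W_close[OF s] LeastI_ex[OF W_cover[OF s]] by blast
    have "(\<lambda>n. h n s - f s) \<longlonglongrightarrow> 0"
    proof (rule Lim_null_comparison)
      show "\<forall>\<^sub>F n in sequentially. norm (h n s - f s) \<le> inverse (real (Suc n))"
        using close by (simp add: abs_minus_commute less_imp_le)
      show "(\<lambda>n. inverse (real (Suc n))) \<longlonglongrightarrow> 0"
        by (rule LIMSEQ_inverse_real_of_nat)
    qed
    then show ?thesis by (rule LIM_zero_cancel)
  qed
  then show ?thesis
    using h_meas by (rule borel_measurable_LIMSEQ_real)
qed

lemma preserved_borel_measurable:
  assumes "space M = Rplus" "sets borel_Rplus \<subseteq> sets M"
  shows "preserved (\<lambda>f. f \<in> borel_measurable M)"
  using assms by (intro preservedI) (rule borel_measurable_of_locally_approx)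

text \<open>Near each point \<open>f\<close> equals its product with an indicator, which
  integrability makes measurable. So it is locally approximated with error 0.\<close>

lemma borel_measurable_of_locally_integrable:
  assumes "space M = Rplus" "sets borel_Rplus \<subseteq> sets M" "locally_integrable M f"
  shows "f \<in> borel_measurable M"
  using assms(1,2)
proof (rule borel_measurable_of_locally_approx)
  fix t :: real assume "t \<in> Rplus"
  then obtain \<eta> where \<eta>: "\<eta> > 0" "set_integrable M (nbhd t \<eta>) f"
    using assms(3) unfolding locally_integrable_def by blast
  then have "(\<lambda>s. indicator (nbhd t \<eta>) s *\<^sub>R f s) \<in> borel_measurable M"
    unfolding set_integrable_def by blast
  then show "locally_approx (\<lambda>g. g \<in> borel_measurable M) f t"
    unfolding locally_approx_def using \<eta>(1)
    by (intro allI impI exI[of _ "\<lambda>s. indicator (nbhd t \<eta>) s *\<^sub>R f s"] conjI exI[of _ \<eta>]) auto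
qed

text \<open>Domination: near each point \<open>f\<close> is bounded by
  \<open>\<bar>g\<bar> + 1\<close> with \<open>g\<close> locally integrable. Local finiteness of the
  measure makes the constant 1 integrable there.\<close>

lemma preserved_locally_integrable:
  assumes space: "space M = Rplus" and borel: "sets borel_Rplus \<subseteq> sets M"
    and finite: "locally_finite_measure M"
  shows "preserved (locally_integrable M)"
proof (rule preservedI)
  fix f assume approx: "\<And>t. t \<in> Rplus \<Longrightarrow> locally_approx (locally_integrable M) f t"
  \<comment> \<open>Domination yields integrability only for measurable \<open>f\<close>, so
    measurability is first inherited from the approximants.\<close>
  have [measurable]: "f \<in> borel_measurable M"
    using space borel
  proof (rule borel_measurable_of_locally_approx)
    show "locally_approx (\<lambda>g. g \<in> borel_measurable M) f t" if "t \<in> Rplus" for t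
      using approx[OF that] borel_measurable_of_locally_integrable[OF space borel]
      by (rule locally_approx_mono)
  qed
  show "locally_integrable M f"
    unfolding locally_integrable_def
  proof
    fix t :: real assume t: "t \<in> Rplus"
    obtain g \<eta>1 where g: "locally_integrable M g" "\<eta>1 > 0"
      "\<And>s. s \<in> nbhd t \<eta>1 \<Longrightarrow> \<bar>f s - g s\<bar> < 1"
      using approx[OF t] by (rule locally_approxE[OF _ zero_less_one]) blast
    obtain \<eta>2 where \<eta>2: "\<eta>2 > 0" "set_integrable M (nbhd t \<eta>2) g"
      using g(1) t unfolding locally_integrable_def by blast
    obtain \<eta>3 where \<eta>3: "\<eta>3 > 0" "emeasure M (nbhd t \<eta>3) < \<infinity>"
      using finite t unfolding locally_finite_measure_def by blast
    \<comment> \<open>Within this radius the approximation holds, \<open>g\<close> is integrable and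
      the measure is finite.\<close>
    define \<eta> where "\<eta> = min \<eta>1 (min \<eta>2 \<eta>3)"
    let ?A = "nbhd t \<eta>"
    have [measurable]: "nbhd t r \<in> sets M" for r
      using borel by (rule sets_nbhd)
    have sub: "?A \<subseteq> nbhd t \<eta>1" "?A \<subseteq> nbhd t \<eta>2" "?A \<subseteq> nbhd t \<eta>3"
      by (auto intro!: nbhd_mono simp: \<eta>_def)
    have "emeasure M ?A < \<infinity>"
      by (rule order_le_less_trans[OF emeasure_mono[OF sub(3)] \<eta>3(2)]) measurable
    then have one: "set_integrable M ?A (\<lambda>_. 1 :: real)"
      unfolding set_integrable_def by simp
    have "set_integrable M ?A g"
      using \<eta>2(2) _ sub(2) by (rule set_integrable_subset) measurable
    then have "set_integrable M ?A (\<lambda>s. \<bar>g s\<bar> + 1)"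
      using one by (intro set_integral_add set_integrable_abs)
    moreover have "set_borel_measurable M ?A f"
      unfolding set_borel_measurable_def by measurable
    moreover have "AE s in M. s \<in> ?A \<longrightarrow> norm (f s) \<le> norm (\<bar>g s\<bar> + 1)"
    proof (intro AE_I2 impI)
      fix s assume "s \<in> ?A"
      then have "\<bar>f s - g s\<bar> < 1" using sub(1) by (intro g(3)) blast
      then show "norm (f s) \<le> norm (\<bar>g s\<bar> + 1)" by simp
    qed
    ultimately have "set_integrable M ?A f"
      by (rule set_integrable_bound)
    moreover have "\<eta> > 0"
      using \<open>\<eta>1 > 0\<close> \<open>\<eta>2 > 0\<close> \<open>\<eta>3 > 0\<close> by (simp add: \<eta>_def)
    ultimately show "\<exists>\<eta>>0. set_integrable M (nbhd t \<eta>) f" by blast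
  qed
qed

theorem proposition5:
  fixes \<F> :: "real set set" and \<mu> :: "real measure" and a :: real
  assumes "sigma_algebra Rplus \<F>" and "sets borel_Rplus \<subseteq> \<F>"
    and "space \<mu> = Rplus" and "sets borel_Rplus \<subseteq> sets \<mu>"
    and "a \<in> Rplus"
  shows
    "preserved lower_semicont \<and> preserved upper_semicont \<and>
     preserved (everywhere right_cont_at) \<and> preserved (everywhere left_cont_at) \<and>
     preserved (everywhere right_lim_at) \<and> preserved (everywhere left_lim_at) \<and>
     preserved (everywhere (all_at {right_cont_at, left_lim_at})) \<and>
     (\<forall>Q\<subseteq>one_sided. Q \<noteq> {} \<longrightarrow> preserved (everywhere (all_at Q))) \<and>
     preserved locally_bounded \<and>
     preserved (\<lambda>f. f \<in> borel_measurable borel_Rplus) \<and>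
     preserved (\<lambda>f. f \<in> borel_measurable (sigma Rplus \<F>)) \<and>
     (locally_finite_measure \<mu> \<longrightarrow> preserved (locally_integrable \<mu>)) \<and>
     preserved (\<lambda>f. approx_cont_at f a) \<and>
     preserved (on_dense_gdelta cont_at) \<and>
     (\<forall>Q\<subseteq>one_sided. Q \<noteq> {} \<longrightarrow> preserved (on_dense_gdelta (all_at Q))) \<and>
     preserved (outside_negligible \<mu> cont_at) \<and>
     (\<forall>Q\<subseteq>one_sided. Q \<noteq> {} \<longrightarrow> preserved (outside_negligible \<mu> (all_at Q)))"
proof -
  interpret F: sigma_algebra Rplus \<F> by fact
  \<comment> \<open>\<open>sigma Rplus \<F>\<close> carries the given \<sigma>-field as a measure
    space; measurability depends only on its space and its sets.\<close>
  have sigma: "space (sigma Rplus \<F>) = Rplus" "sets (sigma Rplus \<F>) = \<F>"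
    using F.space_closed by (simp_all add: space_measure_of_conv F.sets_measure_of_eq)
  have Q: "pointwise_closed (all_at Q)" if "Q \<subseteq> one_sided" for Q
    using that by (intro pointwise_closed_all_at pointwise_closed_one_sided) blast
  have "pointwise_closed (all_at {right_cont_at, left_lim_at})"
    by (rule Q) (simp add: one_sided_def)
  moreover have "pointwise_closed right_cont_at" "pointwise_closed left_cont_at"
    "pointwise_closed right_lim_at" "pointwise_closed left_lim_at"
    by (simp_all add: pointwise_closed_one_sided one_sided_def)
  moreover have "preserved (\<lambda>f. f \<in> borel_measurable borel_Rplus)"
    by (rule preserved_borel_measurable) (simp_all add: space_restrict_space)
  moreover have "preserved (\<lambda>f. f \<in> borel_measurable (sigma Rplus \<F>))"
    using assms(2) by (intro preserved_borel_measurable) (simp_all add: sigma)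
  ultimately show ?thesis
    using Q assms(3-5)
    by (intro conjI allI impI preserved_lower_semicont preserved_upper_semicont
        preserved_everywhere preserved_locally_bounded preserved_locally_integrable
        preserved_at[OF pointwise_closed_approx_cont_at] preserved_on_dense_gdelta
        preserved_outside_negligible pointwise_closed_cont_at)
qed

end
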